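(* Let $d\geq 2$ be an integer and suppose $F\subseteq\mathbb{R}^{d}$ is a universal differentiability set. Then: (i) $\ker(F)\subseteq F$ is a universal differentiability set. (ii) $\ker(\ker(F))=\ker(F)$ and $F\setminus\ker(F)$ is a non-universal differentiability set. In particular, for each Lipschitz function $f:\mathbb{R}^{d}\to\mathbb{R}$, the set of points of $\ker(F)$ at which $f$ is differentiable is a dense subset of $\ker(F)$.
   Context: A set $S\subseteq\mathbb{R}^{d}$ is called a universal differentiability set (UDS) if for every Lipschitz function $f:\mathbb{R}^{d}\to\mathbb{R}$ there is a point $x\in S$ at which $f$ is differentiable (as a function on $\mathbb{R}^d$). A set which is not a UDS is called a non-universal differentiability set (non-UDS). For $S\subseteq\mathbb{R}^{d}$, the kernel of $S$ is $$\ker(S)=S\setminus\left\{x\in S : \exists\,\varepsilon>0\text{ such that }B(x,\varepsilon)\cap S\text{ is a non-UDS}\right\},$$ where $B(x,\varepsilon)$ is the open Euclidean ball with centre $x$ and radius $\varepsilon$. *)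

theory Defs
  imports "HOL-Analysis.Analysis"
begin

definition UDS :: "(real ^ 'n) set \<Rightarrow> bool" where
  "UDS S \<longleftrightarrow>
     (\<forall>f :: real ^ 'n \<Rightarrow> real. (\<exists>L. L-lipschitz_on UNIV f) \<longrightarrow>
        (\<exists>x\<in>S. f differentiable (at x)))"

definition uds_kernel :: "(real ^ 'n) set \<Rightarrow> (real ^ 'n) set" where
  "uds_kernel S = S - {x \<in> S. \<exists>\<epsilon>>0. \<not> UDS (ball x \<epsilon> \<inter> S)}"

end

theory Submission
  imports Defs
begin

text \<open>
  The set removed from \<open>F\<close> in forming the kernel is \<open>F \<inter> U\<close>, where \<open>U\<close> is the open set of points having
  a neighbourhood in which \<open>F\<close> is non-universal. Everything follows from one gluing principle
  (\<open>non_UDS_glue\<close>): if \<open>C\<close> is closed, \<open>F \<inter> C\<close> is non-universal, and \<open>F\<close> is locally non-universal off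
  \<open>C\<close>, then \<open>F\<close> is non-universal. With \<open>C = - U\<close> it says that every universal differentiability set
  \<open>G \<subseteq> F\<close> meets the kernel in a universal differentiability set. The choice \<open>G = F\<close> gives
  universality of the kernel, \<open>G = ball x \<epsilon> \<inter> F\<close> with \<open>x\<close> in the kernel gives idempotence and density,
  and \<open>G = F - uds_kernel F\<close> would make the empty set universal.

  To prove the gluing principle one cannot simply add functions that are bad on the various pieces,
  because the sum of two non-differentiable functions may be differentiable. One wants a sum in which
  at every point of \<open>F\<close> exactly one summand fails to be differentiable. Let \<open>g\<close> be bad on \<open>F \<inter> C\<close>. It is
  first replaced by a Lipschitz function \<open>H\<close> with the same points of differentiability on \<open>C\<close>, and with
  controlled behaviour off \<open>C\<close> (\<open>cone_approximation\<close>): \<open>H\<close> is the supremum of \<open>g\<close> and a family of small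
  cones of a common slope which is steeper than \<open>g\<close>. Off \<open>C\<close> it is locally a maximum of finitely many
  cones. Such a maximum is non-differentiable except on a family of disjoint open sets \<open>W\<close>, on each of
  which it is one cone away from its apex, and which may be taken so small that each \<open>W \<inter> F\<close> is
  non-universal. The cones exceed \<open>g\<close> by at most a nonnegative differentiable function that vanishes
  on \<open>C\<close>, so that \<open>H - g\<close> has derivative zero at the points of \<open>C\<close>.

  It remains to add a Lipschitz function \<open>\<psi>\<close> that is bad on each \<open>W \<inter> F\<close> and differentiable outside the
  sets \<open>W\<close>. Since these sets are disjoint and open, the product of the bad functions for the sets
  \<open>W \<inter> F\<close> with one differentiable function that is positive exactly on their union has this property
  (\<open>obtain_gluing_on_disjoint_open\<close>).
\<close>

section \<open>Differentiable functions positive on a given open set\<close>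

text \<open>
  The tool for transferring differentiability: a perturbation that is dominated by a nonnegative
  differentiable function vanishing at \<open>x\<close> has derivative zero at \<open>x\<close>, because the dominating
  function has a minimum there. It is applied at points about which nothing but this domination is
  known.
\<close>

lemma has_derivative_zero_of_le:
  fixes f \<theta> :: "'a::real_normed_vector \<Rightarrow> real"
  assumes le: "\<And>y. \<bar>f y\<bar> \<le> \<theta> y" and zero: "\<theta> x = 0" and diff: "\<theta> differentiable (at x)"
  shows "(f has_derivative (\<lambda>_. 0)) (at x)"
proof -
  obtain D where D: "(\<theta> has_derivative D) (at x)"
    using diff by (auto simp: differentiable_def)
  have nonneg: "0 \<le> \<theta> y" for y
    using le[of y] by linarith
  have "D = (\<lambda>_. 0)"
    by (rule differential_zero_maxmin[OF _ open_UNIV D]) (auto simp: zero nonneg)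
  then have lim: "((\<lambda>y. (\<theta> y - \<theta> x) /\<^sub>R norm (y - x)) \<longlongrightarrow> 0) (at x)"
    using D by (simp add: has_derivative_at_within)
  have "f x = 0"
    using le[of x] zero by simp
  have "((\<lambda>y. (f y - f x) /\<^sub>R norm (y - x)) \<longlongrightarrow> 0) (at x)"
  proof (rule Lim_null_comparison[OF _ lim], rule always_eventually, rule allI)
    fix y
    show "norm ((f y - f x) /\<^sub>R norm (y - x)) \<le> (\<theta> y - \<theta> x) /\<^sub>R norm (y - x)"
      using le[of y] by (simp add: \<open>f x = 0\<close> zero abs_mult mult_left_mono)
  qed
  then show ?thesis
    by (simp add: has_derivative_at_within)
qed

text \<open>
  For \<open>t \<noteq> 0\<close> this is elementary and only \<open>t = 0\<close> is delicate; the remainder of the first-order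
  expansion at \<open>t\<close> lies between \<open>0\<close> and \<open>(y - t)\<^sup>2\<close>, which treats all \<open>t\<close> at once.
\<close>

lemma has_derivative_positive_part_square:
  fixes t :: real
  shows "((\<lambda>t. (max 0 t)\<^sup>2) has_derivative (\<lambda>h. 2 * max 0 t * h)) (at t)"
proof -
  define rest where "rest y = (max 0 y)\<^sup>2 - (max 0 t)\<^sup>2 - 2 * max 0 t * (y - t)" for y
  have bound: "\<bar>rest y\<bar> \<le> (y - t)\<^sup>2" for y
  proof (cases "t > 0 \<and> y < 0")
    case True
    then have r: "rest y = t\<^sup>2 - 2 * (t * y)"
      by (simp add: rest_def max_def power2_eq_square algebra_simps)
    have "t * y < 0"
      using True by (simp add: mult_pos_neg)
    then have "0 \<le> rest y"
      using r zero_le_power2[of t] by linarith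
    moreover have "(y - t)\<^sup>2 = rest y + y\<^sup>2"
      by (simp add: r power2_eq_square algebra_simps)
    ultimately show ?thesis
      by simp
  next
    case False
    then consider "t \<le> 0" "y \<le> 0" | "t \<le> 0" "y > 0" | "t > 0" "y \<ge> 0" by linarith
    then show ?thesis
    proof cases
      case 1
      then show ?thesis by (simp add: rest_def max_def)
    next
      case 2
      then have "rest y = y\<^sup>2" by (simp add: rest_def max_def)
      moreover have "y\<^sup>2 \<le> (y - t)\<^sup>2"
        using 2 by (intro power_mono) auto
      ultimately show ?thesis by simp
    next
      case 3
      then have "rest y = (y - t)\<^sup>2"
        by (simp add: rest_def max_def power2_eq_square algebra_simps)
      then show ?thesis by simp
    qed
  qed
  have "(rest has_derivative (\<lambda>_. 0)) (at t)"
    by (rule has_derivative_zero_of_le[where \<theta> = "\<lambda>y. (y - t)\<^sup>2"])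
       (auto simp: bound intro!: derivative_intros)
  then have "((\<lambda>y. rest y + (max 0 t)\<^sup>2 + 2 * max 0 t * (y - t)) has_derivative
               (\<lambda>h. 2 * max 0 t * h)) (at t)"
    by (auto intro!: derivative_eq_intros)
  then show ?thesis
    by (simp add: rest_def)
qed

text \<open>
  A multiple of the square of the positive part of \<open>r\<^sup>2 - norm (x - c)\<^sup>2\<close>. Squaring removes the corner
  on the sphere.
\<close>

lemma obtain_differentiable_bump:
  fixes c :: "'a::euclidean_space"
  assumes "r > 0"
  obtains b :: "'a \<Rightarrow> real"
  where "1-lipschitz_on UNIV b" "\<And>x. b differentiable (at x)"
    "\<And>x. 0 \<le> b x" "\<And>x. b x \<le> 1" "\<And>x. b x > 0 \<longleftrightarrow> x \<in> ball c r"
proof -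
  \<comment> \<open>On the ball the squared function is at most \<open>r ^ 4\<close> and its gradient at most \<open>4 * r ^ 3\<close>.\<close>
  define s where "s = 1 / (4 * r ^ 3 + r ^ 4 + 1)"
  have pos: "4 * r ^ 3 + r ^ 4 + 1 > 0"
    using assms by (simp add: add_pos_pos)
  have s: "s > 0" "s * (4 * r ^ 3) \<le> 1" "s * r ^ 4 \<le> 1"
    using assms pos by (auto simp: s_def divide_simps)
  define m where "m x = max 0 (r\<^sup>2 - (x - c) \<bullet> (x - c))" for x
  define b where "b x = s * (m x)\<^sup>2" for x
  define b' where "b' x h = s * (2 * m x * (- 2 * ((x - c) \<bullet> h)))" for x h
  have der: "(b has_derivative b' x) (at x)" for x
  proof -
    have inner: "((\<lambda>x. r\<^sup>2 - (x - c) \<bullet> (x - c)) has_derivative (\<lambda>h. - 2 * ((x - c) \<bullet> h))) (at x)"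
      by (auto intro!: derivative_eq_intros simp: inner_commute)
    have "((\<lambda>x. (max 0 (r\<^sup>2 - (x - c) \<bullet> (x - c)))\<^sup>2) has_derivative
            (\<lambda>h. 2 * m x * (- 2 * ((x - c) \<bullet> h)))) (at x)"
      using has_derivative_compose[OF inner has_derivative_positive_part_square]
      by (simp add: m_def)
    then show ?thesis
      unfolding b_def b'_def m_def by (rule has_derivative_mult_right)
  qed
  have m_pos: "m x > 0 \<longleftrightarrow> x \<in> ball c r" for x
  proof -
    have "m x > 0 \<longleftrightarrow> (norm (x - c))\<^sup>2 < r\<^sup>2"
      by (auto simp: m_def power2_norm_eq_inner)
    also have "\<dots> \<longleftrightarrow> norm (x - c) < r"
      using assms abs_le_square_iff[of r "norm (x - c)"] by (auto simp: not_le[symmetric])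
    finally show ?thesis
      by (simp add: dist_norm norm_minus_commute)
  qed
  have m: "0 \<le> m x" "m x \<le> r\<^sup>2" for x
    by (auto simp: m_def)
  have b'_le: "norm (b' x h) \<le> norm h" for x h
  proof (cases "x \<in> ball c r")
    case False
    then have "m x = 0"
      using m_pos[of x] m(1)[of x] by simp
    then show ?thesis
      by (simp add: b'_def)
  next
    case True
    then have "norm (x - c) \<le> r"
      by (simp add: dist_norm norm_minus_commute)
    then have "\<bar>(x - c) \<bullet> h\<bar> \<le> r * norm h"
      by (meson Cauchy_Schwarz_ineq2 mult_right_mono norm_ge_zero order_trans)
    then have "m x * \<bar>(x - c) \<bullet> h\<bar> \<le> r\<^sup>2 * (r * norm h)"
      using m by (intro mult_mono) auto
    then have "s * (4 * (m x * \<bar>(x - c) \<bullet> h\<bar>)) \<le> s * (4 * (r\<^sup>2 * (r * norm h)))"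
      using s(1) by simp
    also have "\<dots> = (s * (4 * r ^ 3)) * norm h"
      by (simp add: power2_eq_square power3_eq_cube)
    also have "\<dots> \<le> 1 * norm h"
      by (rule mult_right_mono) (use s in auto)
    finally show ?thesis
      using s(1) m(1) by (simp add: b'_def abs_mult)
  qed
  show thesis
  proof
    show "1-lipschitz_on UNIV b"
      by (rule bounded_derivative_imp_lipschitz[where f' = b'])
         (auto intro!: der onorm_bound[of 1, simplified] b'_le[unfolded real_norm_def])
    show "b differentiable (at x)" for x
      using der by (auto simp: differentiable_def)
    show "0 \<le> b x" for x
      using s by (simp add: b_def)
    show "b x \<le> 1" for x
    proof -
      have "(m x)\<^sup>2 \<le> (r\<^sup>2)\<^sup>2"
        using m by (intro power_mono) auto
      also have "\<dots> = r ^ 4"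
        by (simp add: power4_eq_xxxx power2_eq_square)
      finally have "s * (m x)\<^sup>2 \<le> s * r ^ 4"
        using s by (intro mult_left_mono) auto
      also have "\<dots> \<le> 1"
        by (rule s)
      finally show ?thesis
        by (simp add: b_def)
    qed
    show "b x > 0 \<longleftrightarrow> x \<in> ball c r" for x
      using s m_pos[of x] m(1)[of x] by (auto simp: b_def zero_less_mult_iff)
  qed
qed

lemma abs_derivative_le_of_lipschitz:
  fixes f :: "'a::real_normed_vector \<Rightarrow> real"
  assumes lip: "L-lipschitz_on UNIV f" and der: "(f has_derivative f') (at x)"
  shows "\<bar>f' h\<bar> \<le> L * norm h"
proof -
  have "((\<lambda>t. f (x + t *\<^sub>R h)) has_derivative (\<lambda>t. f' (t *\<^sub>R h))) (at 0)"
    by (rule has_derivative_compose[where g=f and f="\<lambda>t. x + t *\<^sub>R h", simplified])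
       (auto intro!: derivative_eq_intros simp: der)
  moreover have "(\<lambda>t. f' (t *\<^sub>R h)) = (\<lambda>t. f' h * t)"
    using has_derivative_bounded_linear[OF der]
    by (auto simp: bounded_linear_def linear_cmul linear_scale fun_eq_iff)
  ultimately have "((\<lambda>t. f (x + t *\<^sub>R h)) has_field_derivative f' h) (at 0)"
    by (simp add: has_field_derivative_def)
  then have "((\<lambda>t. (f (x + t *\<^sub>R h) - f x) / t) \<longlongrightarrow> f' h) (at 0)"
    by (simp add: DERIV_def)
  then have lim: "((\<lambda>t. \<bar>(f (x + t *\<^sub>R h) - f x) / t\<bar>) \<longlongrightarrow> \<bar>f' h\<bar>) (at 0)"
    by (rule tendsto_rabs)
  show ?thesis
  proof (rule tendsto_upperbound[OF lim])
    show "\<forall>\<^sub>F t in at 0. \<bar>(f (x + t *\<^sub>R h) - f x) / t\<bar> \<le> L * norm h"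
    proof (rule eventually_mono[OF eventually_neq_at_within[of 0]])
      fix t :: real assume "t \<noteq> 0"
      have "\<bar>f (x + t *\<^sub>R h) - f x\<bar> \<le> L * (\<bar>t\<bar> * norm h)"
        using lipschitz_on_normD[OF lip, of "x + t *\<^sub>R h" x] by simp
      then show "\<bar>(f (x + t *\<^sub>R h) - f x) / t\<bar> \<le> L * norm h"
        using \<open>t \<noteq> 0\<close> by (simp add: abs_divide divide_simps mult_ac)
    qed
  qed simp
qed

text \<open>
  With the weights \<open>(1/2) ^ (n + 1)\<close> the series of derivatives converges uniformly on the whole space,
  so the sum stays differentiable everywhere, even where infinitely many terms are active.
\<close>

lemma weighted_series_of_differentiable_lipschitz:
  fixes b :: "nat \<Rightarrow> 'a::real_normed_vector \<Rightarrow> real"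
  assumes lip: "\<And>n. 1-lipschitz_on UNIV (b n)"
    and diff: "\<And>n x. b n differentiable (at x)"
    and b: "\<And>n x. 0 \<le> b n x" "\<And>n x. b n x \<le> 1"
  obtains \<theta> :: "'a \<Rightarrow> real" where "1-lipschitz_on UNIV \<theta>" "\<And>x. \<theta> differentiable (at x)"
    "\<And>x. 0 \<le> \<theta> x" "\<And>x. \<theta> x \<le> 1" "\<And>x. \<theta> x > 0 \<longleftrightarrow> (\<exists>n. b n x > 0)"
proof -
  define w :: "nat \<Rightarrow> real" where "w n = (1/2) ^ Suc n" for n
  have w: "w sums 1" and w_pos: "w n > 0" for n
    unfolding w_def using power_half_series by auto
  have w_sum: "summable w" "suminf w = 1"
    using w by (auto simp: sums_iff)
  define \<theta> where "\<theta> x = (\<Sum>n. w n * b n x)" for x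
  have sm: "summable (\<lambda>n. w n * b n x)" for x
    by (rule summable_comparison_test'[OF w_sum(1), of 0])
       (use b w_pos in \<open>auto simp: abs_mult less_imp_le mult_left_le\<close>)
  have le1: "\<theta> x \<le> 1" for x
    unfolding \<theta>_def w_sum(2)[symmetric]
    by (rule suminf_le[OF _ sm w_sum(1)]) (use b w_pos in \<open>auto simp: less_imp_le mult_left_le\<close>)
  have nonneg: "0 \<le> \<theta> x" for x
    unfolding \<theta>_def by (rule suminf_nonneg[OF sm]) (use b w_pos in \<open>auto simp: less_imp_le\<close>)
  have pos: "\<theta> x > 0 \<longleftrightarrow> (\<exists>n. b n x > 0)" for x
  proof -
    have "0 < w n * b n x \<longleftrightarrow> 0 < b n x" for n
      using w_pos[of n] by (simp add: zero_less_mult_iff)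
    then show ?thesis
      unfolding \<theta>_def using b w_pos by (simp add: suminf_pos_iff[OF sm] less_imp_le)
  qed
  obtain b' where b': "(b n has_derivative b' n x) (at x)" for n x
    using diff unfolding differentiable_def by metis
  have b'_le: "\<bar>b' n x h\<bar> \<le> norm h" for n x h
    using abs_derivative_le_of_lipschitz[OF lip b'] by simp
  have sm': "summable (\<lambda>n. w n * b' n x h)" for x h
    by (rule summable_comparison_test'[OF summable_mult2[OF w_sum(1), of "norm h"], of 0])
       (use b'_le w_pos in \<open>auto simp: abs_mult less_imp_le mult_left_mono\<close>)
  define \<theta>' where "\<theta>' x h = (\<Sum>n. w n * b' n x h)" for x h
  have "\<exists>g. \<forall>x\<in>UNIV. (\<lambda>n. w n * b n x) sums g x \<and> (g has_derivative \<theta>' x) (at x within UNIV)"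
  proof (rule has_derivative_series[where x = 0])
    show "((\<lambda>x. w n * b n x) has_derivative (\<lambda>h. w n * b' n x h)) (at x within UNIV)" for n x
      using b' by (auto intro!: has_derivative_mult_right)
    show "(\<lambda>n. w n * b n 0) sums \<theta> 0"
      unfolding \<theta>_def using sm by (rule summable_sums)
    fix e :: real assume "e > 0"
    have "(\<lambda>n. \<Sum>i. w (i + n)) \<longlonglongrightarrow> 0"
      by (rule suminf_exist_split2[OF w_sum(1)])
    then have "\<forall>\<^sub>F n in sequentially. (\<Sum>i. w (i + n)) < e"
      using \<open>e > 0\<close> by (rule order_tendstoD)
    then show "\<forall>\<^sub>F n in sequentially. \<forall>x\<in>UNIV. \<forall>h.
        norm ((\<Sum>i<n. w i * b' i x h) - \<theta>' x h) \<le> e * norm h"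
    proof eventually_elim
      case (elim n)
      show ?case
      proof (intro ballI allI)
        fix x h
        have "(\<Sum>i<n. w i * b' i x h) - \<theta>' x h = - (\<Sum>i. w (i + n) * b' (i + n) x h)"
          unfolding \<theta>'_def using suminf_split_initial_segment[OF sm'[of x h], of n] by simp
        also have "norm \<dots> \<le> (\<Sum>i. w (i + n) * norm h)"
          unfolding norm_minus_cancel
          by (rule norm_suminf_le)
             (use b'_le w_pos w_sum in \<open>auto simp: abs_mult less_imp_le mult_left_mono
                intro!: summable_mult2 summable_ignore_initial_segment\<close>)
        also have "\<dots> = (\<Sum>i. w (i + n)) * norm h"
          by (rule suminf_mult2[symmetric]) (use w_sum in \<open>auto intro!: summable_ignore_initial_segment\<close>)
        also have "\<dots> \<le> e * norm h"
          using elim by (intro mult_right_mono) auto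
        finally show "norm ((\<Sum>i<n. w i * b' i x h) - \<theta>' x h) \<le> e * norm h" .
      qed
    qed
  qed auto
  then obtain g where g: "\<And>x. (\<lambda>n. w n * b n x) sums g x" "\<And>x. (g has_derivative \<theta>' x) (at x)"
    by auto
  have "g = \<theta>"
    unfolding \<theta>_def using g(1) by (auto simp: sums_iff)
  have "\<bar>\<theta>' x h\<bar> \<le> norm h" for x h
  proof -
    have "norm (\<theta>' x h) \<le> (\<Sum>n. w n * norm h)"
      unfolding \<theta>'_def by (rule norm_suminf_le)
        (use b'_le w_pos w_sum in \<open>auto simp: abs_mult less_imp_le mult_left_mono intro!: summable_mult2\<close>)
    then show ?thesis
      using w_sum by (simp add: suminf_mult2[symmetric])
  qed
  then have "1-lipschitz_on UNIV \<theta>"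
    by (intro bounded_derivative_imp_lipschitz[where f' = \<theta>'])
       (use g(2) \<open>g = \<theta>\<close> in \<open>auto intro!: onorm_bound[of 1, simplified]\<close>)
  moreover have "\<theta> differentiable (at x)" for x
    using g(2) \<open>g = \<theta>\<close> by (auto simp: differentiable_def)
  ultimately show thesis
    by (intro that[of \<theta>] nonneg le1 pos)
qed

text \<open>
  Multiplying a bounded function that is supported in \<open>W\<close> by such a \<open>\<theta>\<close> makes it differentiable off \<open>W\<close>,
  and does not change at which points of \<open>W\<close> it is differentiable.
\<close>

lemma obtain_differentiable_positive_on_open:
  fixes W :: "'a::euclidean_space set"
  assumes "open W"
  obtains \<theta> :: "'a \<Rightarrow> real"
  where "1-lipschitz_on UNIV \<theta>" "\<And>x. \<theta> differentiable (at x)"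
    "\<And>x. 0 \<le> \<theta> x" "\<And>x. \<theta> x \<le> 1" "\<And>x. \<theta> x > 0 \<longleftrightarrow> x \<in> W"
proof (cases "W = {}")
  case True
  show thesis
    by (rule that[of "\<lambda>_. 0"]) (use True in \<open>auto intro: lipschitz_onI\<close>)
next
  case False
  obtain r where r: "\<And>x. x \<in> W \<Longrightarrow> r x > 0 \<and> ball x (r x) \<subseteq> W"
    using assms unfolding open_contains_ball by metis
  obtain \<F> where \<F>: "\<F> \<subseteq> (\<lambda>x. ball x (r x)) ` W" "countable \<F>"
    "\<Union>\<F> = \<Union>((\<lambda>x. ball x (r x)) ` W)"
    by (rule Lindelof[of "(\<lambda>x. ball x (r x)) ` W"]) auto
  have union: "\<Union>\<F> = W"
    using \<F>(3) r by force
  then have "\<F> \<noteq> {}"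
    using False by auto
  define B where "B = from_nat_into \<F>"
  have range: "range B = \<F>"
    unfolding B_def by (rule range_from_nat_into[OF \<open>\<F> \<noteq> {}\<close> \<F>(2)])
  have "\<exists>b :: 'a \<Rightarrow> real. 1-lipschitz_on UNIV b \<and> (\<forall>x. b differentiable (at x)) \<and>
          (\<forall>x. 0 \<le> b x \<and> b x \<le> 1 \<and> (b x > 0 \<longleftrightarrow> x \<in> B n))" for n
  proof -
    have "B n \<in> (\<lambda>x. ball x (r x)) ` W"
      using range \<F>(1) by auto
    then obtain c where c: "c \<in> W" "B n = ball c (r c)"
      by auto
    show ?thesis
      by (rule obtain_differentiable_bump[of "r c" c]) (use c r in auto)
  qed
  then obtain b :: "nat \<Rightarrow> 'a \<Rightarrow> real" where b: "\<And>n. 1-lipschitz_on UNIV (b n)"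
    "\<And>n x. b n differentiable (at x)" "\<And>n x. 0 \<le> b n x" "\<And>n x. b n x \<le> 1"
    "\<And>n x. b n x > 0 \<longleftrightarrow> x \<in> B n"
    by metis
  show thesis
  proof (rule weighted_series_of_differentiable_lipschitz[OF b(1-4)])
    fix \<theta> :: "'a \<Rightarrow> real"
    assume "\<And>x. \<theta> x > 0 \<longleftrightarrow> (\<exists>n. b n x > 0)"
    moreover have "(\<exists>n. b n x > 0) \<longleftrightarrow> x \<in> W" for x
      using b(5) range union by blast
    ultimately have "\<And>x. \<theta> x > 0 \<longleftrightarrow> x \<in> W"
      by simp
    then show "1-lipschitz_on UNIV \<theta> \<Longrightarrow> (\<And>x. \<theta> differentiable (at x)) \<Longrightarrow>
        (\<And>x. 0 \<le> \<theta> x) \<Longrightarrow> (\<And>x. \<theta> x \<le> 1) \<Longrightarrow> thesis"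
      by (intro that)
  qed
qed

section \<open>Gluing over disjoint open sets\<close>

text \<open>
  Take \<open>f W\<close> times a fixed differentiable \<open>\<theta>\<close> that is positive exactly on the union. No compatibility
  of the functions \<open>f W\<close> is required: a segment leaving some \<open>W\<close> meets its frontier, and \<open>\<theta>\<close> vanishes
  there because an open set disjoint from \<open>W\<close> cannot contain a frontier point of \<open>W\<close>. This controls the
  oscillation of the product between different members of the family.
\<close>

lemma obtain_gluing_on_disjoint_open:
  fixes f :: "'a::euclidean_space set \<Rightarrow> 'a \<Rightarrow> real"
  assumes "disjoint \<W>" and "\<And>W. W \<in> \<W> \<Longrightarrow> open W"
    and f: "\<And>W. W \<in> \<W> \<Longrightarrow> 1-lipschitz_on UNIV (f W)"
      "\<And>W x. W \<in> \<W> \<Longrightarrow> x \<in> W \<Longrightarrow> \<bar>f W x\<bar> \<le> 1"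
  obtains \<psi> :: "'a \<Rightarrow> real" where "2-lipschitz_on UNIV \<psi>"
    "\<And>x. x \<notin> \<Union>\<W> \<Longrightarrow> \<psi> differentiable (at x)"
    "\<And>W x. W \<in> \<W> \<Longrightarrow> x \<in> W \<Longrightarrow> \<psi> differentiable (at x) \<Longrightarrow> f W differentiable (at x)"
proof -
  have "open (\<Union>\<W>)"
    using assms(2) by blast
  then obtain \<theta> :: "'a \<Rightarrow> real" where \<theta>: "1-lipschitz_on UNIV \<theta>" "\<And>x. \<theta> differentiable (at x)"
    "\<And>x. 0 \<le> \<theta> x" "\<And>x. \<theta> x \<le> 1" "\<And>x. \<theta> x > 0 \<longleftrightarrow> x \<in> \<Union>\<W>"
    by (rule obtain_differentiable_positive_on_open) blast
  have \<theta>0: "\<theta> x = 0" if "x \<notin> \<Union>\<W>" for x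
    using \<theta>(3)[of x] \<theta>(5)[of x] that by auto
  define \<psi> where "\<psi> x = (if x \<in> \<Union>\<W> then \<theta> x * f (THE W. W \<in> \<W> \<and> x \<in> W) x else 0)" for x
  have \<psi>: "\<psi> x = \<theta> x * f W x" if "W \<in> \<W>" "x \<in> W" for x W
  proof -
    have "(THE W. W \<in> \<W> \<and> x \<in> W) = W"
      using that \<open>disjoint \<W>\<close> by (intro the_equality) (auto simp: disjoint_def)
    then show ?thesis
      using that by (auto simp: \<psi>_def)
  qed
  have le: "\<bar>\<psi> x\<bar> \<le> \<theta> x" for x
  proof (cases "x \<in> \<Union>\<W>")
    case True
    then obtain W where W: "W \<in> \<W>" "x \<in> W"
      by blast
    show ?thesis
      using mult_left_mono[OF f(2)[OF W] \<theta>(3)[of x]] \<theta>(3)[of x] by (simp add: \<psi>[OF W] abs_mult)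
  next
    case False
    then show ?thesis
      using \<theta>(3) unfolding \<psi>_def by auto
  qed
  have lip_zero: "\<bar>\<psi> x\<bar> \<le> norm (x - w)" if "\<theta> w = 0" for x w
    using lipschitz_on_normD[OF \<theta>(1), of x w] le[of x] that \<theta>(3)[of x] by simp
  \<comment> \<open>Two values in different pieces are compared through a zero of \<open>\<theta>\<close> on the segment.\<close>
  have across: "\<bar>\<psi> x - \<psi> y\<bar> \<le> 2 * norm (x - y)"
    if W: "W \<in> \<W>" "x \<in> W" "y \<notin> W" for x y W
  proof -
    have "closed_segment x y \<inter> frontier W \<noteq> {}"
      by (rule connected_Int_frontier) (use W in auto)
    then obtain w where w: "w \<in> closed_segment x y" "w \<in> frontier W"
      by blast
    have "w \<notin> \<Union>\<W>"
    proof
      assume "w \<in> \<Union>\<W>"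
      then obtain V where V: "V \<in> \<W>" "w \<in> V"
        by blast
      have "w \<notin> W" "w \<in> closure W"
        using w(2) assms(2)[OF W(1)] by (auto simp: frontier_def interior_open)
      then have "V \<inter> W \<noteq> {}"
        using V assms(2)[OF V(1)] open_Int_closure_eq_empty[of V W] by auto
      then show False
        using \<open>disjoint \<W>\<close> V W \<open>w \<notin> W\<close> by (auto simp: disjoint_def)
    qed
    then have "\<bar>\<psi> x\<bar> \<le> norm (x - w)" "\<bar>\<psi> y\<bar> \<le> norm (y - w)"
      using lip_zero \<theta>0 by auto
    moreover have "norm (x - w) + norm (y - w) = norm (x - y)"
      using w(1) unfolding between_mem_segment[symmetric] between
      by (simp add: dist_norm norm_minus_commute)
    ultimately show ?thesis
      by simp
  qed
  have same: "\<bar>\<psi> x - \<psi> y\<bar> \<le> 2 * norm (x - y)" if W: "W \<in> \<W>" "x \<in> W" "y \<in> W" for x y W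
  proof -
    have "\<psi> x - \<psi> y = \<theta> x * (f W x - f W y) + f W y * (\<theta> x - \<theta> y)"
      using W by (simp add: \<psi> algebra_simps)
    also have "\<bar>\<dots>\<bar> \<le> \<theta> x * \<bar>f W x - f W y\<bar> + \<bar>f W y\<bar> * \<bar>\<theta> x - \<theta> y\<bar>"
      using \<theta>(3)[of x] by (metis abs_mult abs_of_nonneg abs_triangle_ineq)
    also have "\<dots> \<le> 1 * norm (x - y) + 1 * norm (x - y)"
      using lipschitz_on_normD[OF f(1)[OF W(1)], of x y] lipschitz_on_normD[OF \<theta>(1), of x y]
        f(2)[OF W(1,3)] \<theta>(3,4)[of x]
      by (intro add_mono mult_mono) auto
    finally show ?thesis
      by simp
  qed
  have lip: "\<bar>\<psi> x - \<psi> y\<bar> \<le> 2 * norm (x - y)" for x y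
  proof -
    consider W where "W \<in> \<W>" "x \<in> W" | W where "W \<in> \<W>" "y \<in> W" | "x \<notin> \<Union>\<W>" "y \<notin> \<Union>\<W>"
      by blast
    then show ?thesis
    proof cases
      case 1
      then show ?thesis using across same by blast
    next
      case 2
      then show ?thesis
        using across[of W y x] same[of W y x] by (auto simp: norm_minus_commute abs_minus_commute)
    next
      case 3
      then have "\<psi> x = 0" "\<psi> y = 0"
        unfolding \<psi>_def by auto
      then show ?thesis by simp
    qed
  qed
  show thesis
  proof
    show "2-lipschitz_on UNIV \<psi>"
      by (rule lipschitz_onI) (use lip in \<open>auto simp: dist_norm\<close>)
    show "\<psi> differentiable (at x)" if "x \<notin> \<Union>\<W>" for x
      using has_derivative_zero_of_le[OF le \<theta>0[OF that] \<theta>(2)] by (auto simp: differentiable_def)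
    show "f W differentiable (at x)" if W: "W \<in> \<W>" "x \<in> W" and diff: "\<psi> differentiable (at x)"
      for W x
    proof -
      have pos: "\<theta> y > 0" if "y \<in> W" for y
        using that W(1) \<theta>(5) by blast
      have "(\<lambda>y. \<psi> y / \<theta> y) differentiable (at x)"
        using diff \<theta>(2) pos[OF W(2)] by (intro differentiable_divide) auto
      then obtain D where "((\<lambda>y. \<psi> y / \<theta> y) has_derivative D) (at x)"
        by (auto simp: differentiable_def)
      then have "(f W has_derivative D) (at x)"
        by (rule has_derivative_transform_within_open[OF _ assms(2)[OF W(1)] W(2)])
           (use \<psi>[OF W(1)] pos in \<open>auto simp: less_imp_neq[THEN not_sym]\<close>)
      then show ?thesis
        by (auto simp: differentiable_def)
    qed
  qed
qed

section \<open>Approximation by cones\<close>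

text \<open>
  Exhaust \<open>U\<close> by compact sets and cover the \<open>n\<close>-th one by finitely many balls of radius less than
  \<open>1 / (n + 1)\<close>. Only finitely many of all these balls exceed a given size; this is what will make a
  supremum of functions attached to the balls locally a maximum of finitely many of them. The covering
  by the balls of half the radius leaves the room that is needed to see that these functions are large
  near every point of \<open>U\<close>.
\<close>

lemma obtain_balls_covering_open:
  fixes U :: "'a::euclidean_space set"
  assumes "open U"
    and small: "\<And>z. z \<in> U \<Longrightarrow> \<exists>\<rho>>0. \<forall>r. 0 < r \<and> r < \<rho> \<longrightarrow> Q z r"
  obtains I :: "('a \<times> real) set"
  where "\<And>\<epsilon>. \<epsilon> > 0 \<Longrightarrow> finite {(z, r) \<in> I. r \<ge> \<epsilon>}"
    "\<And>z r. (z, r) \<in> I \<Longrightarrow> 0 < r \<and> Q z r"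
    "\<And>x. x \<in> U \<Longrightarrow> \<exists>(z, r)\<in>I. x \<in> ball z (r / 2)"
proof -
  obtain C :: "nat \<Rightarrow> 'a set"
    where C: "\<And>n. compact (C n)" "\<And>n. C n \<subseteq> U" "\<Union>(range C) = U"
    by (rule open_Union_compact_subsets[OF \<open>open U\<close>]) blast
  obtain \<rho> where \<rho>: "\<And>z. z \<in> U \<Longrightarrow> \<rho> z > 0" "\<And>z r. z \<in> U \<Longrightarrow> 0 < r \<Longrightarrow> r < \<rho> z \<Longrightarrow> Q z r"
    using small by metis
  define R where "R n z = min (\<rho> z) (1 / real (Suc n)) / 2" for n :: nat and z
  have R: "0 < R n z" "R n z < \<rho> z" "R n z < 1 / real (Suc n)" if "z \<in> U" for n z
    using \<rho>(1)[OF that] by (auto simp: R_def min_def field_simps)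
  have "\<exists>T. finite T \<and> T \<subseteq> C n \<and> C n \<subseteq> (\<Union>z\<in>T. ball z (R n z / 2))" for n
  proof -
    have "C n \<subseteq> (\<Union>z\<in>C n. ball z (R n z / 2))"
      using C(2) R(1) by (force simp: subset_iff)
    then show ?thesis
      using compactE_image[OF C(1)[of n], of "C n" "\<lambda>z. ball z (R n z / 2)"] by (metis open_ball)
  qed
  then obtain T where T: "\<And>n. finite (T n)" "\<And>n. T n \<subseteq> C n"
    "\<And>n. C n \<subseteq> (\<Union>z\<in>T n. ball z (R n z / 2))"
    by metis
  define I where "I = (\<Union>n. (\<lambda>z. (z, R n z)) ` T n)"
  have TU: "z \<in> U" if "z \<in> T n" for z n
    using that T(2) C(2) by blast
  show thesis
  proof
    show "finite {(z, r) \<in> I. r \<ge> \<epsilon>}" if "\<epsilon> > 0" for \<epsilon>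
    proof (rule finite_subset)
      show "{(z, r) \<in> I. r \<ge> \<epsilon>} \<subseteq> (\<Union>n\<in>{..nat \<lceil>1 / \<epsilon>\<rceil>}. (\<lambda>z. (z, R n z)) ` T n)"
      proof safe
        fix z r assume "(z, r) \<in> I" "\<epsilon> \<le> r"
        then obtain n where n: "z \<in> T n" "r = R n z"
          by (auto simp: I_def)
        then have "\<epsilon> < 1 / real (Suc n)"
          using R(3)[OF TU[OF n(1)], of n] \<open>\<epsilon> \<le> r\<close> by simp
        then have "real (Suc n) < 1 / \<epsilon>"
          using that by (simp add: field_simps)
        then have "n \<le> nat \<lceil>1 / \<epsilon>\<rceil>"
          by linarith
        then show "(z, r) \<in> (\<Union>n\<in>{..nat \<lceil>1 / \<epsilon>\<rceil>}. (\<lambda>z. (z, R n z)) ` T n)"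
          using n by auto
      qed
    qed (use T(1) in auto)
    show "0 < r \<and> Q z r" if zr: "(z, r) \<in> I" for z r
    proof -
      obtain n where n: "z \<in> T n" "r = R n z"
        using zr by (auto simp: I_def)
      then show ?thesis
        using R[OF TU[OF n(1)], of n] \<rho>(2)[OF TU[OF n(1)], of r] by simp
    qed
    show "\<exists>(z, r)\<in>I. x \<in> ball z (r / 2)" if "x \<in> U" for x
    proof -
      obtain n where "x \<in> C n"
        using \<open>x \<in> U\<close> C(3) by blast
      then obtain z where "z \<in> T n" "x \<in> ball z (R n z / 2)"
        using T(3) by blast
      then show ?thesis
        by (auto simp: I_def intro!: bexI[of _ "(z, R n z)"])
    qed
  qed
qed

text \<open>
  The function \<open>H\<close> is the supremum of \<open>g\<close> and of countably many small downward cones of slope 2, steeper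
  than the Lipschitz constant of \<open>g\<close>. Each cone exceeds \<open>g\<close> only on a small ball around its apex, on
  which it stays below \<open>g + \<theta>\<close>, and at every point with \<open>\<theta> > 0\<close> some cone is above \<open>g\<close>. Since the
  sizes of the cones tend to zero, \<open>H\<close> is near such a point the maximum of finitely many cones.

  The geometric point is that this maximum always has a kink unless it is, near the point, one single
  cone seen away from its apex. Indeed, where \<open>H\<close> is differentiable, all cones that touch it have the
  same gradient, so their apexes lie on one ray issuing from the point. Since all slopes are equal, the
  cone with the farthest apex then dominates the other ones everywhere. Its apex cannot be the point
  itself, because a cone is not differentiable at its apex.

  The set attached to a cone consists of the points near which it is the active cone with the
  farthest apex. Requiring it to be strictly farther makes these sets pairwise disjoint, also when two
  cones agree on an open set.
\<close>

lemma cone_approximation: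
  fixes g \<theta> :: "'a::euclidean_space \<Rightarrow> real" and P :: "'a set \<Rightarrow> bool"
  assumes g: "1-lipschitz_on UNIV g"
    and \<theta>: "continuous_on UNIV \<theta>" "\<And>x. 0 \<le> \<theta> x"
    and local: "\<And>x. \<theta> x > 0 \<Longrightarrow> \<exists>\<epsilon>>0. P (ball x \<epsilon>)"
    and mono: "\<And>V V'. P V \<Longrightarrow> V' \<subseteq> V \<Longrightarrow> P V'"
  obtains H :: "'a \<Rightarrow> real" and \<W> where "2-lipschitz_on UNIV H"
    "\<And>x. g x \<le> H x" "\<And>x. H x \<le> g x + \<theta> x" "disjoint \<W>"
    "\<And>W. W \<in> \<W> \<Longrightarrow> open W \<and> bounded W \<and> P W"
    "\<And>W x. W \<in> \<W> \<Longrightarrow> x \<in> W \<Longrightarrow> H differentiable (at x)"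
    "\<And>x. \<theta> x > 0 \<Longrightarrow> H differentiable (at x) \<Longrightarrow> x \<in> \<Union>\<W>"
proof -
  \<comment> \<open>A cone of size \<open>r\<close> can exceed \<open>g\<close> by at most \<open>2 * r\<close>, and only within distance \<open>2 * r\<close> of \<open>z\<close>.\<close>
  define Q where "Q z r \<longleftrightarrow> P (ball z (3 * r)) \<and> (\<forall>y\<in>ball z (3 * r). 2 * r \<le> \<theta> y)" for z r
  have "open {x. \<theta> x > 0}"
    using \<theta>(1) by (simp add: open_Collect_less)
  moreover have "\<exists>\<rho>>0. \<forall>r. 0 < r \<and> r < \<rho> \<longrightarrow> Q z r" if "z \<in> {x. \<theta> x > 0}" for z
  proof -
    have pos: "\<theta> z > 0"
      using that by simp
    obtain \<epsilon> where \<epsilon>: "\<epsilon> > 0" "P (ball z \<epsilon>)"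
      using local[OF pos] by blast
    have "\<forall>\<^sub>F y in nhds z. \<theta> y > \<theta> z / 2"
      using \<theta>(1) pos by (intro order_tendstoD(1)[of \<theta> "\<theta> z"])
        (auto simp: continuous_on_eq_continuous_at isCont_def tendsto_at_iff_tendsto_nhds)
    then obtain d where d: "d > 0" "\<And>y. dist y z < d \<Longrightarrow> \<theta> y > \<theta> z / 2"
      unfolding eventually_nhds_metric by blast
    have "Q z r" if r: "0 < r" "r < min (\<theta> z / 4) (min d \<epsilon> / 3)" for r
      unfolding Q_def
    proof
      show "P (ball z (3 * r))"
        using r by (intro mono[OF \<epsilon>(2)]) auto
      show "\<forall>y\<in>ball z (3 * r). 2 * r \<le> \<theta> y"
      proof
        fix y assume "y \<in> ball z (3 * r)"
        then have "\<theta> y > \<theta> z / 2"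
          using r by (intro d(2)) (auto simp: dist_commute)
        then show "2 * r \<le> \<theta> y"
          using r by simp
      qed
    qed
    then show ?thesis
      using pos d(1) \<epsilon>(1) by (intro exI[of _ "min (\<theta> z / 4) (min d \<epsilon> / 3)"]) auto
  qed
  ultimately obtain I :: "('a \<times> real) set"
    where fin: "\<And>\<epsilon>. \<epsilon> > 0 \<Longrightarrow> finite {(z, r) \<in> I. r \<ge> \<epsilon>}"
      and I: "\<And>z r. (z, r) \<in> I \<Longrightarrow> 0 < r \<and> Q z r"
      and cover: "\<And>x. x \<in> {x. \<theta> x > 0} \<Longrightarrow> \<exists>(z, r)\<in>I. x \<in> ball z (r / 2)"
    by (rule obtain_balls_covering_open[where U = "{x. \<theta> x > 0}" and Q = Q]) (assumption, (rule that; assumption))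
  define cone where "cone k y = g (fst k) + 2 * (snd k - norm (y - fst k))" for k y
  have g_le: "\<bar>g x - g y\<bar> \<le> norm (x - y)" for x y
    using lipschitz_on_normD[OF g, of x y] by simp
  have cone_le: "cone k y \<le> g y + 2 * snd k - norm (y - fst k)" for k y
    using g_le[of y "fst k"] by (simp add: cone_def)
  have cone_le_\<theta>: "cone k y \<le> g y + \<theta> y" if "k \<in> I" for k y
  proof (cases "y \<in> ball (fst k) (3 * snd k)")
    case True
    then have "2 * snd k \<le> \<theta> y"
      using I[of "fst k" "snd k"] that by (auto simp: Q_def)
    then show ?thesis
      using cone_le[of k y] norm_ge_zero[of "y - fst k"] by linarith
  next
    case False
    then have "norm (y - fst k) \<ge> 3 * snd k"
      by (simp add: dist_norm norm_minus_commute)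
    then show ?thesis
      using cone_le[of k y] \<theta>(2)[of y] I[of "fst k" "snd k"] that by auto
  qed
  have cone_lip: "cone k x \<le> cone k y + 2 * norm (x - y)" for k x y
    using norm_triangle_ineq[of "y - x" "x - fst k"] by (simp add: cone_def norm_minus_commute)
  define H where "H y = Sup (insert (g y) ((\<lambda>k. cone k y) ` I))" for y
  have bdd: "bdd_above (insert (g y) ((\<lambda>k. cone k y) ` I))" for y
    using cone_le_\<theta> by (auto intro!: bdd_aboveI[of _ "g y + \<theta> y"])
  have H_ge_g: "g y \<le> H y" for y
    unfolding H_def by (rule cSup_upper[OF _ bdd]) auto
  have H_ge_cone: "cone k y \<le> H y" if "k \<in> I" for k y
    unfolding H_def by (rule cSup_upper[OF _ bdd]) (use that in auto)
  have H_least: "H y \<le> c" if "g y \<le> c" "\<And>k. k \<in> I \<Longrightarrow> cone k y \<le> c" for y c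
    unfolding H_def by (rule cSup_least) (use that in auto)
  have H_le: "H y \<le> g y + \<theta> y" for y
    by (rule H_least) (use \<theta>(2) cone_le_\<theta> in auto)
  have H_lip': "H x \<le> H y + 2 * norm (x - y)" for x y
  proof (rule H_least)
    show "g x \<le> H y + 2 * norm (x - y)"
      using g_le[of x y] H_ge_g[of y] norm_ge_zero[of "x - y"] by linarith
    show "cone k x \<le> H y + 2 * norm (x - y)" if "k \<in> I" for k
      using cone_lip[of k x y] H_ge_cone[OF that, of y] by linarith
  qed
  have H_lip: "2-lipschitz_on UNIV H"
  proof (rule lipschitz_onI)
    show "dist (H x) (H y) \<le> 2 * dist x y" for x y
      using H_lip'[of x y] H_lip'[of y x] by (simp add: dist_norm norm_minus_commute abs_le_iff)
  qed simp
  have H_cont: "isCont H x" for x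
    using lipschitz_on_continuous_on[OF H_lip] by (simp add: continuous_on_eq_continuous_at)
  have g_cont: "isCont g x" for x
    using lipschitz_on_continuous_on[OF g] by (simp add: continuous_on_eq_continuous_at)
  have cone_cont: "isCont (cone k) x" for k x
    unfolding cone_def[abs_def] by (intro continuous_intros)
  have eventually_less: "\<forall>\<^sub>F y in nhds x. u y < v y"
    if "isCont u x" "isCont v x" "u x < v x" for u v :: "'a \<Rightarrow> real" and x
  proof -
    have "((\<lambda>y. v y - u y) \<longlongrightarrow> v x - u x) (nhds x)"
      using that by (intro tendsto_diff) (auto simp: isCont_def tendsto_at_iff_tendsto_nhds)
    then have "\<forall>\<^sub>F y in nhds x. v y - u y > 0"
      by (rule order_tendstoD) (use that in simp)
    then show ?thesis
      by (simp add: less_diff_eq)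
  qed
  define active where "active y = {k \<in> I. cone k y = H y}" for y
  have active_near: "finite (active x) \<and> (\<forall>\<^sub>F y in nhds x. active y \<noteq> {} \<and> active y \<subseteq> active x)"
    if pos: "\<theta> x > 0" for x
  proof -
    obtain z r where zr: "(z, r) \<in> I" "x \<in> ball z (r / 2)"
      using cover[of x] pos by auto
    define k where "k = (z, r)"
    have above: "g x < cone k x"
      using g_le[of x z] zr(2) by (simp add: k_def cone_def dist_norm norm_minus_commute)
    define c where "c = (cone k x - g x) / 2"
    have "cone k x - g x \<le> 2 * snd k"
      using cone_le[of k x] norm_ge_zero[of "x - fst k"] by linarith
    then have c: "c > 0" "c \<le> snd k"
      using above by (auto simp: c_def)
    define A where "A = {(z, r) \<in> I. r \<ge> c / 2}"
    have A: "finite A" "k \<in> A" "A \<subseteq> I"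
      using fin[of "c / 2"] c zr by (auto simp: A_def k_def)
    \<comment> \<open>Cones of size below \<open>c / 2\<close> exceed \<open>g\<close> by less than \<open>c\<close>, hence stay below cone \<open>k\<close> near \<open>x\<close>.\<close>
    have lower: "\<forall>\<^sub>F y in nhds x. g y + c < cone k y"
      by (rule eventually_less) (use g_cont cone_cont above in \<open>auto simp: c_def field_simps\<close>)
    have in_A: "active y \<noteq> {} \<and> active y \<subseteq> A" if y: "g y + c < cone k y" for y
    proof -
      have small: "cone j y < cone k y" if "j \<in> I" "j \<notin> A" for j
      proof -
        have "snd j < c / 2"
          using that by (cases j) (auto simp: A_def)
        then show ?thesis
          using y cone_le[of j y] norm_ge_zero[of "y - fst j"] by linarith
      qed
      define M where "M = Max ((\<lambda>j. cone j y) ` A)"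
      have M: "cone j y \<le> M" if "j \<in> A" for j
        unfolding M_def using A(1) that by simp
      have "H y \<le> M"
      proof (rule H_least)
        show "g y \<le> M"
          using y M[OF A(2)] c by linarith
        show "cone j y \<le> M" if "j \<in> I" for j
          using small[OF that] M[of j] M[OF A(2)] by fastforce
      qed
      moreover have "M \<in> (\<lambda>j. cone j y) ` A"
        unfolding M_def using A by (intro Max_in) auto
      then obtain j where j: "j \<in> A" "cone j y = M"
        by auto
      ultimately have "j \<in> active y"
        using H_ge_cone[of j y] A(3) by (auto simp: active_def)
      moreover have "active y \<subseteq> A"
        using small H_ge_cone[of k y] A(2,3) by (force simp: active_def)
      ultimately show ?thesis
        by blast
    qed
    have "g x + c < cone k x"
      using above by (simp add: c_def field_simps)
    then have "finite (active x)"
      using in_A A(1) finite_subset by blast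
    moreover have "\<forall>\<^sub>F y in nhds x. \<forall>j\<in>A - active x. cone j y < H y"
    proof (rule eventually_ball_finite)
      show "\<forall>j\<in>A - active x. \<forall>\<^sub>F y in nhds x. cone j y < H y"
      proof
        fix j assume "j \<in> A - active x"
        then have "cone j x < H x"
          using H_ge_cone[of j x] A(3) by (force simp: active_def)
        then show "\<forall>\<^sub>F y in nhds x. cone j y < H y"
          using H_cont cone_cont by (intro eventually_less)
      qed
    qed (use A(1) in simp)
    then have "\<forall>\<^sub>F y in nhds x. active y \<noteq> {} \<and> active y \<subseteq> active x"
      using lower
    proof eventually_elim
      case (elim y)
      have "j \<in> active x" if "j \<in> active y" for j
      proof (rule ccontr)
        assume "j \<notin> active x"
        then have "cone j y < H y"
          using elim in_A[of y] that by blast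
        then show False
          using that by (simp add: active_def)
      qed
      then show ?case
        using elim in_A[of y] by blast
    qed
    ultimately show ?thesis
      by blast
  qed
  have cone_der: "(cone k has_derivative (\<lambda>h. - 2 * (h \<bullet> sgn (x - fst k)))) (at x)"
    if "x \<noteq> fst k" for k x
  proof -
    have "((\<lambda>y. norm (y - fst k)) has_derivative (\<lambda>h. h \<bullet> sgn (x - fst k))) (at x)"
    proof (rule has_derivative_compose[where f = "\<lambda>y. y - fst k" and f' = "\<lambda>h. h" and g = norm])
      show "((\<lambda>y. y - fst k) has_derivative (\<lambda>h. h)) (at x)"
        by (auto intro!: derivative_eq_intros)
      show "(norm has_derivative (\<lambda>h. h \<bullet> sgn (x - fst k))) (at (x - fst k))"
        using that by (intro has_derivative_norm) simp
    qed
    then show ?thesis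
      unfolding cone_def[abs_def] by (auto intro!: derivative_eq_intros)
  qed
  \<comment> \<open>A function touching \<open>H\<close> from below at \<open>x\<close> shares its derivative, since the difference has a minimum.\<close>
  have gradient: "D = (\<lambda>h. - 2 * (h \<bullet> sgn (x - fst j)))"
    if D: "(H has_derivative D) (at x)" and j: "j \<in> active x" "x \<noteq> fst j" for D x j
  proof -
    have "(\<lambda>h. D h - (- 2 * (h \<bullet> sgn (x - fst j)))) = (\<lambda>_. 0)"
      by (rule differential_zero_maxmin[OF _ open_UNIV has_derivative_diff[OF D cone_der[OF j(2)]]])
         (use H_ge_cone j in \<open>auto simp: active_def\<close>)
    then show ?thesis
      unfolding fun_eq_iff right_minus_eq .
  qed
  define S where "S k = {y. y \<noteq> fst k \<and> k \<in> active y \<and>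
      (\<forall>j\<in>active y. j \<noteq> k \<longrightarrow> norm (y - fst j) < norm (y - fst k))}" for k
  have inS: "x \<in> \<Union>((\<lambda>k. interior (S k)) ` I)"
    if pos: "\<theta> x > 0" and diff: "H differentiable (at x)" for x
  proof -
    obtain D where D: "(H has_derivative D) (at x)"
      using diff by (auto simp: differentiable_def)
    have fin: "finite (active x)"
      and near: "\<forall>\<^sub>F y in nhds x. active y \<noteq> {} \<and> active y \<subseteq> active x"
      using active_near[OF pos] by auto
    have "active x \<noteq> {}"
      using eventually_nhds_x_imp_x[OF near] by blast
    define t where "t = Max ((\<lambda>j. norm (x - fst j)) ` active x)"
    have "t \<in> (\<lambda>j. norm (x - fst j)) ` active x"
      unfolding t_def using fin \<open>active x \<noteq> {}\<close> by (intro Max_in) auto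
    then obtain k where k: "k \<in> active x" "norm (x - fst k) = t"
      by auto
    have far: "norm (x - fst j) \<le> t" if "j \<in> active x" for j
      unfolding t_def using fin that by simp
    have "k \<in> I"
      using k by (simp add: active_def)
    have eq_k: "j = k" if "j \<in> active x" "fst j = fst k" for j
      using that k(1) by (auto simp: active_def cone_def prod_eq_iff)
    \<comment> \<open>Otherwise every active apex is at \<open>x\<close>, and \<open>H\<close> is a single cone near its apex.\<close>
    have "x \<noteq> fst k"
    proof
      assume apex: "x = fst k"
      then have single: "active x = {k}"
        using far k eq_k by fastforce
      have ev: "\<forall>\<^sub>F y in nhds x. H y = H x - 2 * norm (y - x)"
        using near
      proof eventually_elim
        case (elim y)
        then have "k \<in> active y"
          by (auto simp: single subset_singleton_iff)
        then show ?case
          using k(1) apex by (simp add: active_def cone_def)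
      qed
      then obtain V where V: "open V" "x \<in> V" "\<And>y. y \<in> V \<Longrightarrow> H y = H x - 2 * norm (y - x)"
        unfolding eventually_nhds by blast
      have "D = (\<lambda>_. 0)"
        by (rule differential_zero_maxmin[OF V(2,1) D]) (use V(3) in force)
      then have "((\<lambda>y. (H y - H x) /\<^sub>R norm (y - x)) \<longlongrightarrow> 0) (at x)"
        using D by (simp add: has_derivative_at_within)
      then have "\<forall>\<^sub>F y in at x. dist ((H y - H x) /\<^sub>R norm (y - x)) 0 < 1"
        by (rule tendstoD) simp
      moreover have "\<forall>\<^sub>F y in at x. y \<in> V" "\<forall>\<^sub>F y in at x. y \<noteq> x"
        using V by (auto intro: eventually_at_in_open' simp: eventually_neq_at_within)
      ultimately have "\<forall>\<^sub>F y in at x. False"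
      proof eventually_elim
        case (elim y)
        then show False
          using V(3)[of y] by (simp add: abs_mult field_simps)
      qed
      then show False
        by simp
    qed
    then have "t > 0"
      using k(2) by auto
    define u where "u = sgn (x - fst k)"
    have u: "norm u = 1" "x - fst k = t *\<^sub>R u"
      using \<open>x \<noteq> fst k\<close> k(2) by (auto simp: u_def norm_sgn sgn_div_norm)
    \<comment> \<open>Equal gradients put all apexes on the ray through \<open>fst k\<close>; an apex at \<open>x\<close> itself fits trivially.\<close>
    have ray: "x - fst j = norm (x - fst j) *\<^sub>R u" if "j \<in> active x" for j
    proof (cases "x = fst j")
      case False
      have "h \<bullet> sgn (x - fst j) = h \<bullet> u" for h
        using gradient[OF D that False] gradient[OF D k(1) \<open>x \<noteq> fst k\<close>]
        by (simp add: u_def fun_eq_iff)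
      then have "sgn (x - fst j) = u"
        by (metis vector_eq_ldot)
      then show ?thesis
        using False by (auto simp: sgn_div_norm)
    qed simp
    have closer: "norm (x - fst j) < norm (x - fst k)" if "j \<in> active x" "j \<noteq> k" for j
    proof -
      have "norm (x - fst j) \<noteq> t"
      proof
        assume "norm (x - fst j) = t"
        then have "x - fst j = x - fst k"
          using ray[OF that(1)] u(2) by simp
        then show False
          using eq_k[OF that(1)] that(2) by simp
      qed
      then show ?thesis
        using far[OF that(1)] k(2) by simp
    qed
    \<comment> \<open>The apex of cone \<open>j\<close> lies on cone \<open>k\<close>, and all slopes are equal.\<close>
    have dominated: "cone j y \<le> cone k y" if "j \<in> active x" for j y
    proof -
      have "fst j - fst k = (t - norm (x - fst j)) *\<^sub>R u"
        using ray[OF that] u(2) by (simp add: algebra_simps)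
      then have "norm (fst j - fst k) = t - norm (x - fst j)"
        using far[OF that] u(1) by simp
      moreover have "norm (y - fst k) \<le> norm (y - fst j) + norm (fst j - fst k)"
        using norm_triangle_ineq[of "y - fst j" "fst j - fst k"] by simp
      moreover have "cone j x = cone k x"
        using that k(1) by (simp add: active_def)
      ultimately show ?thesis
        using k(2) by (simp add: cone_def)
    qed
    have "\<forall>\<^sub>F y in nhds x. \<forall>j\<in>active x - {k}. norm (y - fst j) < norm (y - fst k)"
    proof (rule eventually_ball_finite)
      show "\<forall>j\<in>active x - {k}. \<forall>\<^sub>F y in nhds x. norm (y - fst j) < norm (y - fst k)"
        by (intro ballI eventually_less continuous_intros) (use closer in auto)
    qed (use fin in simp)
    moreover have "\<forall>\<^sub>F y in nhds x. y \<noteq> fst k"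
      using \<open>x \<noteq> fst k\<close> by (rule t1_space_nhds)
    ultimately have "\<forall>\<^sub>F y in nhds x. y \<in> S k"
      using near
    proof eventually_elim
      case (elim y)
      then obtain j where j: "j \<in> active y" "j \<in> active x"
        by blast
      then have "k \<in> active y"
        using dominated[OF j(2), of y] H_ge_cone[OF \<open>k \<in> I\<close>, of y] \<open>k \<in> I\<close>
        by (auto simp: active_def)
      then show ?case
        using elim by (auto simp: S_def)
    qed
    then have "x \<in> interior (S k)"
      unfolding eventually_nhds interior_def by blast
    then show ?thesis
      using \<open>k \<in> I\<close> by blast
  qed
  have S_sub: "S k \<subseteq> ball (fst k) (3 * snd k)" if "k \<in> I" for k
  proof
    fix y assume "y \<in> S k"
    then have "g y \<le> cone k y"
      using H_ge_g[of y] by (simp add: S_def active_def)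
    then have "norm (y - fst k) \<le> 2 * snd k"
      using cone_le[of k y] by simp
    then show "y \<in> ball (fst k) (3 * snd k)"
      using I[of "fst k" "snd k"] that by (simp add: dist_norm norm_minus_commute)
  qed
  show thesis
  proof (rule that[of H "(\<lambda>k. interior (S k)) ` I"])
    show "disjoint ((\<lambda>k. interior (S k)) ` I)"
    proof (rule disjointI)
      fix V W assume "V \<in> (\<lambda>k. interior (S k)) ` I" "W \<in> (\<lambda>k. interior (S k)) ` I" "V \<noteq> W"
      then obtain j k where jk: "V = interior (S j)" "W = interior (S k)" "j \<noteq> k"
        by blast
      then have "S j \<inter> S k = {}"
        by (fastforce simp: S_def)
      then show "V \<inter> W = {}"
        using jk interior_subset by blast
    qed
    fix W assume "W \<in> (\<lambda>k. interior (S k)) ` I"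
    then obtain k where k: "k \<in> I" "W = interior (S k)"
      by blast
    have W: "W \<subseteq> S k" "open W"
      unfolding k(2) by (auto simp: interior_subset)
    show "open W \<and> bounded W \<and> P W"
    proof (intro conjI)
      show "bounded W"
        using W(1) S_sub[OF k(1)] bounded_ball bounded_subset by blast
      have "P (ball (fst k) (3 * snd k))"
        using I[of "fst k" "snd k"] k(1) by (simp add: Q_def)
      then show "P W"
        using W(1) S_sub[OF k(1)] by (blast intro: mono)
    qed (rule W)
    show "H differentiable (at x)" if "x \<in> W" for x
    proof -
      have "x \<noteq> fst k"
        using that W(1) by (auto simp: S_def)
      then have "(H has_derivative (\<lambda>h. - 2 * (h \<bullet> sgn (x - fst k)))) (at x)"
        by (rule has_derivative_transform_within_open[OF cone_der W(2) that])
           (use W(1) in \<open>auto simp: S_def active_def\<close>)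
      then show ?thesis
        by (auto simp: differentiable_def)
    qed
  qed (use H_lip H_ge_g H_le inS in auto)
qed

section \<open>Gluing non-universal differentiability sets\<close>

lemma non_UDS_subset: "\<not> UDS S \<Longrightarrow> T \<subseteq> S \<Longrightarrow> \<not> UDS T"
  unfolding UDS_def by blast

lemma non_UDS_normalized_witness:
  fixes S W :: "(real ^ 'n) set"
  assumes "\<not> UDS S" and "bounded W"
  obtains f :: "real ^ 'n \<Rightarrow> real" where "1-lipschitz_on UNIV f" "\<And>x. x \<in> W \<Longrightarrow> \<bar>f x\<bar> \<le> 1"
    "\<And>x. x \<in> S \<Longrightarrow> \<not> f differentiable (at x)"
proof -
  obtain f :: "real ^ 'n \<Rightarrow> real" and L where f: "L-lipschitz_on UNIV f"
    "\<And>x. x \<in> S \<Longrightarrow> \<not> f differentiable (at x)"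
    using \<open>\<not> UDS S\<close> unfolding UDS_def by blast
  obtain R where R: "\<And>x. x \<in> W \<Longrightarrow> norm x \<le> R"
    using \<open>bounded W\<close> bounded_iff by blast
  have L: "0 \<le> L"
    by (rule lipschitz_on_nonneg[OF f(1)])
  define a where "a = L + \<bar>f 0\<bar> + L * \<bar>R\<bar> + 1"
  have a: "a > 0" "L \<le> a"
    using L by (auto simp: a_def add_nonneg_pos)
  have bound: "\<bar>f x\<bar> \<le> a" if "x \<in> W" for x
  proof -
    have "\<bar>f x - f 0\<bar> \<le> L * norm x"
      using lipschitz_on_normD[OF f(1), of x 0] by simp
    also have "\<dots> \<le> L * \<bar>R\<bar>"
      using R[OF that] L by (intro mult_left_mono) auto
    finally show ?thesis
      using L by (simp add: a_def)
  qed
  show thesis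
  proof (rule that[of "\<lambda>x. (1 / a) * f x"])
    have "(\<bar>1 / a\<bar> * L)-lipschitz_on UNIV (\<lambda>x. (1 / a) * f x)"
      by (rule lipschitz_on_cmult_real[OF f(1)])
    then show "1-lipschitz_on UNIV (\<lambda>x. (1 / a) * f x)"
      by (rule lipschitz_on_mono) (use a in auto)
    show "\<bar>1 / a * f x\<bar> \<le> 1" if "x \<in> W" for x
      using bound[OF that] a by (simp add: abs_mult)
    show "\<not> (\<lambda>x. 1 / a * f x) differentiable (at x)" if "x \<in> S" for x
    proof
      assume "(\<lambda>x. 1 / a * f x) differentiable (at x)"
      then have "(\<lambda>x. a * (1 / a * f x)) differentiable (at x)"
        by (rule differentiable_mult[OF differentiable_const])
      moreover have "(\<lambda>x. a * (1 / a * f x)) = f"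
        using a by auto
      ultimately show False
        using f(2)[OF that] by (simp only:)
    qed
  qed
qed

text \<open>
  Let \<open>g\<close> be a bad function for \<open>F \<inter> C\<close>. Replacing it by its cone approximation \<open>H\<close> keeps it bad on
  \<open>F \<inter> C\<close>, since \<open>H\<close> and \<open>g\<close> have the same derivatives on \<open>C\<close>; off \<open>C\<close> the only points of
  differentiability of \<open>H\<close> lie in the disjoint open sets \<open>W\<close>. Adding \<open>\<psi>\<close>, which is bad on \<open>F \<inter> W\<close> for
  each \<open>W\<close> and differentiable off these sets, destroys differentiability there and nowhere restores
  it. At each point of \<open>F\<close> exactly one of the two summands is differentiable.
\<close>

lemma non_UDS_glue:
  fixes F C :: "(real ^ 'n) set"
  assumes "closed C" and C: "\<not> UDS (F \<inter> C)"
    and local: "\<And>x. x \<notin> C \<Longrightarrow> \<exists>\<epsilon>>0. \<not> UDS (ball x \<epsilon> \<inter> F)"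
  shows "\<not> UDS F"
proof -
  obtain g :: "real ^ 'n \<Rightarrow> real"
    where g: "1-lipschitz_on UNIV g" "\<And>x. x \<in> F \<inter> C \<Longrightarrow> \<not> g differentiable (at x)"
    by (rule non_UDS_normalized_witness[OF C bounded_empty]) blast
  obtain \<theta> :: "real ^ 'n \<Rightarrow> real" where \<theta>: "1-lipschitz_on UNIV \<theta>" "\<And>x. \<theta> differentiable (at x)"
    "\<And>x. 0 \<le> \<theta> x" "\<And>x. \<theta> x > 0 \<longleftrightarrow> x \<in> - C"
    using \<open>closed C\<close> by (auto intro: obtain_differentiable_positive_on_open[of "- C"])
  have loc: "\<exists>\<epsilon>>0. \<not> UDS (ball x \<epsilon> \<inter> F)" if "\<theta> x > 0" for x
    using local that \<theta>(4) by blast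
  have mono: "\<not> UDS (V' \<inter> F)" if "\<not> UDS (V \<inter> F)" "V' \<subseteq> V" for V V'
    using that non_UDS_subset[of "V \<inter> F" "V' \<inter> F"] by blast
  obtain H :: "real ^ 'n \<Rightarrow> real" and \<W> where H: "2-lipschitz_on UNIV H"
    "\<And>x. g x \<le> H x" "\<And>x. H x \<le> g x + \<theta> x" and \<W>: "disjoint \<W>"
    "\<And>W. W \<in> \<W> \<Longrightarrow> open W \<and> bounded W \<and> \<not> UDS (W \<inter> F)"
    and diff: "\<And>W x. W \<in> \<W> \<Longrightarrow> x \<in> W \<Longrightarrow> H differentiable (at x)"
    "\<And>x. \<theta> x > 0 \<Longrightarrow> H differentiable (at x) \<Longrightarrow> x \<in> \<Union>\<W>"
    by (rule cone_approximation[OF g(1) lipschitz_on_continuous_on[OF \<theta>(1)] \<theta>(3) loc mono])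
      (assumption | rule that)+
  have "\<exists>f :: real ^ 'n \<Rightarrow> real. 1-lipschitz_on UNIV f \<and> (\<forall>x\<in>W. \<bar>f x\<bar> \<le> 1) \<and>
          (\<forall>x\<in>W \<inter> F. \<not> f differentiable (at x))" if "W \<in> \<W>" for W
  proof -
    have "\<not> UDS (W \<inter> F)" "bounded W"
      using \<W>(2)[OF that] by auto
    then show ?thesis
      by (rule non_UDS_normalized_witness) blast
  qed
  then obtain f :: "(real ^ 'n) set \<Rightarrow> real ^ 'n \<Rightarrow> real" where f: "\<And>W. W \<in> \<W> \<Longrightarrow> 1-lipschitz_on UNIV (f W)"
    "\<And>W x. W \<in> \<W> \<Longrightarrow> x \<in> W \<Longrightarrow> \<bar>f W x\<bar> \<le> 1"
    "\<And>W x. W \<in> \<W> \<Longrightarrow> x \<in> W \<inter> F \<Longrightarrow> \<not> f W differentiable (at x)"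
    by metis
  obtain \<psi> :: "real ^ 'n \<Rightarrow> real" where \<psi>: "2-lipschitz_on UNIV \<psi>"
    "\<And>x. x \<notin> \<Union>\<W> \<Longrightarrow> \<psi> differentiable (at x)"
    "\<And>W x. W \<in> \<W> \<Longrightarrow> x \<in> W \<Longrightarrow> \<psi> differentiable (at x) \<Longrightarrow> f W differentiable (at x)"
  proof (rule obtain_gluing_on_disjoint_open[OF \<W>(1) _ f(1,2)])
    show "open W" if "W \<in> \<W>" for W
      using \<W>(2)[OF that] by blast
  qed (assumption | rule that)+
  have "\<not> (\<lambda>x. H x + \<psi> x) differentiable (at x)" if "x \<in> F" for x
  proof
    assume sum: "(\<lambda>x. H x + \<psi> x) differentiable (at x)"
    show False
    proof (cases "x \<in> \<Union>\<W>")
      case True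
      then obtain W where W: "W \<in> \<W>" "x \<in> W"
        by blast
      have "\<psi> differentiable (at x)"
        using differentiable_diff[OF sum diff(1)[OF W]] by simp
      then show False
        using \<psi>(3)[OF W] f(3)[OF W(1)] W(2) \<open>x \<in> F\<close> by blast
    next
      case False
      have H_diff: "H differentiable (at x)"
        using differentiable_diff[OF sum \<psi>(2)[OF False]] by simp
      then have "x \<in> C"
        using diff(2) \<theta>(4) False by blast
      then have "\<theta> x = 0"
        using \<theta>(3)[of x] \<theta>(4)[of x] by auto
      have "\<bar>H y - g y\<bar> \<le> \<theta> y" for y
        using H(2,3)[of y] by simp
      then have "((\<lambda>y. H y - g y) has_derivative (\<lambda>_. 0)) (at x)"
        using \<open>\<theta> x = 0\<close> \<theta>(2) by (rule has_derivative_zero_of_le)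
      then have "(\<lambda>y. H y - g y) differentiable (at x)"
        by (auto simp: differentiable_def)
      then have "g differentiable (at x)"
        using differentiable_diff[OF H_diff] by fastforce
      then show False
        using g(2) \<open>x \<in> C\<close> \<open>x \<in> F\<close> by blast
    qed
  qed
  moreover have "(2 + 2)-lipschitz_on UNIV (\<lambda>x. H x + \<psi> x)"
    by (rule lipschitz_on_add[OF H(1) \<psi>(1)])
  ultimately show ?thesis
    unfolding UDS_def by blast
qed

section \<open>The kernel\<close>

text \<open>
  The kernel is \<open>F - U\<close> for an open set \<open>U\<close> in which \<open>F\<close>, hence \<open>G\<close>, is locally
  non-universal. So if the rest \<open>G - U\<close> were also non-universal, the gluing lemma would apply to \<open>G\<close>.
\<close>

lemma UDS_Int_uds_kernel:
  fixes F G :: "(real ^ 'n) set"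
  assumes "UDS G" and "G \<subseteq> F"
  shows "UDS (G \<inter> uds_kernel F)"
proof (rule ccontr)
  assume non: "\<not> UDS (G \<inter> uds_kernel F)"
  define U where "U = {x. \<exists>\<epsilon>>0. \<not> UDS (ball x \<epsilon> \<inter> F)}"
  have "open U"
    unfolding open_contains_ball
  proof
    fix x assume "x \<in> U"
    then obtain \<epsilon> where \<epsilon>: "\<epsilon> > 0" "\<not> UDS (ball x \<epsilon> \<inter> F)"
      by (auto simp: U_def)
    have "y \<in> U" if y: "y \<in> ball x \<epsilon>" for y
    proof -
      obtain \<delta> where "\<delta> > 0" "ball y \<delta> \<subseteq> ball x \<epsilon>"
        using openE[OF open_ball y] by blast
      then show ?thesis
        using non_UDS_subset[OF \<epsilon>(2), of "ball y \<delta> \<inter> F"] by (auto simp: U_def)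
    qed
    then show "\<exists>e>0. ball x e \<subseteq> U"
      using \<epsilon>(1) by blast
  qed
  have kernel: "uds_kernel F = F - U"
    by (auto simp: uds_kernel_def U_def)
  have "\<not> UDS G"
  proof (rule non_UDS_glue)
    show "closed (- U)"
      using \<open>open U\<close> by (rule closed_Compl)
    show "\<not> UDS (G \<inter> - U)"
    proof -
      have "G \<inter> uds_kernel F = G \<inter> - U"
        using \<open>G \<subseteq> F\<close> by (auto simp: kernel)
      then show ?thesis
        using non by simp
    qed
    show "\<exists>\<epsilon>>0. \<not> UDS (ball x \<epsilon> \<inter> G)" if x: "x \<notin> - U" for x
    proof -
      obtain \<epsilon> where \<epsilon>: "\<epsilon> > 0" "\<not> UDS (ball x \<epsilon> \<inter> F)"
        using x by (auto simp: U_def)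
      then show ?thesis
        using non_UDS_subset[OF \<epsilon>(2), of "ball x \<epsilon> \<inter> G"] \<open>G \<subseteq> F\<close> by blast
    qed
  qed
  then show False
    using \<open>UDS G\<close> by simp
qed

theorem theorem2p3:
  fixes F :: "(real ^ 'n) set"
  assumes "CARD('n) \<ge> 2"
    and "UDS F"
  shows "uds_kernel F \<subseteq> F \<and> UDS (uds_kernel F) \<and>
         uds_kernel (uds_kernel F) = uds_kernel F \<and> \<not> UDS (F - uds_kernel F) \<and>
         (\<forall>f :: real ^ 'n \<Rightarrow> real. (\<exists>L. L-lipschitz_on UNIV f) \<longrightarrow>
            uds_kernel F \<subseteq> closure {x \<in> uds_kernel F. f differentiable (at x)})"
proof -
  have sub: "uds_kernel F \<subseteq> F"
    by (auto simp: uds_kernel_def)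
  have local: "UDS (ball x \<epsilon> \<inter> uds_kernel F)" if "x \<in> uds_kernel F" "\<epsilon> > 0" for x \<epsilon>
  proof -
    have "UDS (ball x \<epsilon> \<inter> F)"
      using that by (auto simp: uds_kernel_def)
    then have "UDS ((ball x \<epsilon> \<inter> F) \<inter> uds_kernel F)"
      by (rule UDS_Int_uds_kernel) simp
    then show ?thesis
      using sub by (simp add: Int_assoc Int_absorb1)
  qed
  have "UDS (uds_kernel F)"
    using UDS_Int_uds_kernel[OF \<open>UDS F\<close> order_refl] sub by (simp add: Int_absorb1)
  moreover have "uds_kernel (uds_kernel F) = uds_kernel F"
    using local unfolding uds_kernel_def[of "uds_kernel F"] by blast
  moreover have "\<not> UDS (F - uds_kernel F)"
  proof
    assume "UDS (F - uds_kernel F)"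
    then have "UDS ((F - uds_kernel F) \<inter> uds_kernel F)"
      by (rule UDS_Int_uds_kernel) blast
    then have "UDS ({} :: (real ^ 'n) set)"
      by (simp add: Diff_disjoint Int_commute)
    then show False
      unfolding UDS_def using lipschitz_on_constant by blast
  qed
  moreover have "uds_kernel F \<subseteq> closure {x \<in> uds_kernel F. f differentiable (at x)}"
    if f: "\<exists>L. L-lipschitz_on UNIV f" for f :: "real ^ 'n \<Rightarrow> real"
  proof
    fix x assume x: "x \<in> uds_kernel F"
    show "x \<in> closure {x \<in> uds_kernel F. f differentiable (at x)}"
      unfolding closure_approachable
    proof (intro allI impI)
      fix \<epsilon> :: real assume "\<epsilon> > 0"
      then obtain y where "y \<in> ball x \<epsilon> \<inter> uds_kernel F" "f differentiable (at y)"
        using local[OF x] f unfolding UDS_def by blast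
      then show "\<exists>y\<in>{x \<in> uds_kernel F. f differentiable (at x)}. dist y x < \<epsilon>"
        by (auto simp: dist_commute)
    qed
  qed
  ultimately show ?thesis
    using sub by blast
qed

end
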